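(* Let $F,H_i,G_j,F_{i,j}\in\mathcal{S}^p$ and $\mathcal{B}(\mathbf{x},\mathbf{y})=F+\sum_{i=1}^m x_iH_i+\sum_{j=1}^n y_jG_j+\sum_{i,j}x_iy_jF_{i,j}$; consider the BMI optimization problem of maximizing a linear function $g(\mathbf{z})$ over $\mathbf{z}=(\mathbf{x},\mathbf{y})\in\mathbb{R}^{m+n}$ subject to $\mathcal{B}(\mathbf{x},\mathbf{y})\preceq0$. Let $\mathcal{B}=\mathcal{B}^+-\mathcal{B}^-$ be the difference-of-convex decomposition obtained from a splitting $M=M_1-M_2$, $M_1,M_2\succeq0$, of $M=\begin{pmatrix}0&\Gamma\\\Gamma^{\mathsf T}&0\end{pmatrix}$ (with $\Gamma$ the block matrix with $(i,j)$-block $\frac12F_{i,j}$), namely $\mathcal{B}^+(\mathbf{z})=(\mathbf{z}\otimes I)^{\mathsf T}M_1(\mathbf{z}\otimes I)+(H_1\cdots H_m\,G_1\cdots G_n)(\mathbf{z}\otimes I)+F$ and $\mathcal{B}^-(\mathbf{z})=(\mathbf{z}\otimes I)^{\mathsf T}M_2(\mathbf{z}\otimes I)$. Let $\mathbf{z}^0$ be a strictly feasible solution of the BMI problem, fix $\delta<0$, and for $k=0,1,\dots$ let $\mathbf{z}^{k+1}$ be an optimal solution of the convex program: maximize $g(\mathbf{z})+\frac12\delta\|\mathbf{z}-\mathbf{z}^k\|_2^2$ subject to $\mathcal{B}^+(\mathbf{z})-\mathcal{B}^-(\mathbf{z}^k)-\mathcal{D}\mathcal{B}^-(\mathbf{z}^k)(\mathbf{z}-\mathbf{z}^k)\preceq0$,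 stopping after finitely many steps $k$ (Algorithm BMI-DC). Then every returned point $\mathbf{z}^i$, $i=0,\dots,k$, is a feasible solution of the original BMI problem, i.e., $\mathcal{B}(\mathbf{z}^i)\preceq0$.
   Context: $\mathcal{S}^p$ denotes the real symmetric $p\times p$ matrices; $A\preceq B$ means $B-A$ is positive semidefinite. $\otimes$ is the Kronecker product and $I$ the $p\times p$ identity. $\mathcal{D}\mathcal{B}^-(\mathbf{z})(\mathbf{u})=\sum_{i=1}^{m+n}u_i\frac{\partial\mathcal{B}^-}{\partial z_i}(\mathbf{z})$. A solution is strictly feasible if the matrix inequality holds strictly ($\prec0$). *)

theory Defs
  imports "HOL-Analysis.Analysis"
begin

definition sym_matrix :: "real^'k^'k \<Rightarrow> bool" where
  "sym_matrix A \<longleftrightarrow> transpose A = A"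

definition psd :: "real^'k^'k \<Rightarrow> bool" where
  "psd A \<longleftrightarrow> sym_matrix A \<and> (\<forall>v. 0 \<le> v \<bullet> (A *v v))"

definition pos_def :: "real^'k^'k \<Rightarrow> bool" where
  "pos_def A \<longleftrightarrow> sym_matrix A \<and> (\<forall>v. v \<noteq> 0 \<longrightarrow> 0 < v \<bullet> (A *v v))"

definition loewner_le :: "real^'k^'k \<Rightarrow> real^'k^'k \<Rightarrow> bool"  (infix "\<preceq>" 50) where
  "A \<preceq> B \<longleftrightarrow> psd (B - A)"

definition loewner_less :: "real^'k^'k \<Rightarrow> real^'k^'k \<Rightarrow> bool"  (infix "\<prec>" 50) where
  "A \<prec> B \<longleftrightarrow> pos_def (B - A)"

text \<open>
  A point \<open>z = (x, y)\<close> of \<open>\<real>\<^sup>m\<^sup>+\<^sup>n\<close> is a vector indexed by the sum type, with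
  \<open>x\<^sub>i = z $ Inl i\<close> and \<open>y\<^sub>j = z $ Inr j\<close>.  Matrices made of \<open>p \<times> p\<close> blocks are indexed by
  pairs (block index, index inside the block).
\<close>

definition x_part :: "real^('m::finite + 'n::finite) \<Rightarrow> real^'m" where
  "x_part z = (\<chi> i. z $ Inl i)"

definition y_part :: "real^('m::finite + 'n::finite) \<Rightarrow> real^'n" where
  "y_part z = (\<chi> j. z $ Inr j)"

definition bmi ::
  "real^'p^'p \<Rightarrow> ('m::finite \<Rightarrow> real^'p^'p) \<Rightarrow> ('n::finite \<Rightarrow> real^'p^'p)
    \<Rightarrow> ('m \<Rightarrow> 'n \<Rightarrow> real^'p^'p) \<Rightarrow> real^'m \<Rightarrow> real^'n \<Rightarrow> real^'p^'p" where
  "bmi F H G Fm x y =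
     F + (\<Sum>i\<in>UNIV. (x $ i) *\<^sub>R H i) + (\<Sum>j\<in>UNIV. (y $ j) *\<^sub>R G j)
       + (\<Sum>i\<in>UNIV. \<Sum>j\<in>UNIV. (x $ i * y $ j) *\<^sub>R Fm i j)"

text \<open>
  Kronecker product of a column vector with a matrix; the trivial column index of the vector
  is dropped, so that the columns of the product are those of the matrix.
\<close>

definition kron_vec :: "real^'k \<Rightarrow> real^'q^'p \<Rightarrow> real^'q^('k::finite \<times> 'p::finite)"
    (infixr "\<otimes>\<^sub>v" 75) where
  "z \<otimes>\<^sub>v A = (\<chi> r b. z $ fst r * A $ snd r $ b)"

definition Gamma_mat ::
  "('m::finite \<Rightarrow> 'n::finite \<Rightarrow> real^'p^'p) \<Rightarrow> real^('n \<times> 'p::finite)^('m \<times> 'p)" where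
  "Gamma_mat Fm = (\<chi> r c. ((1/2) *\<^sub>R Fm (fst r) (fst c)) $ snd r $ snd c)"

definition M_mat ::
  "('m::finite \<Rightarrow> 'n::finite \<Rightarrow> real^'p^'p)
    \<Rightarrow> real^(('m + 'n) \<times> 'p::finite)^(('m + 'n) \<times> 'p)" where
  "M_mat Fm = (\<chi> r c.
     (case (fst r, fst c) of
        (Inl i, Inl i') \<Rightarrow> 0
      | (Inl i, Inr j) \<Rightarrow> Gamma_mat Fm $ (i, snd r) $ (j, snd c)
      | (Inr j, Inl i) \<Rightarrow> transpose (Gamma_mat Fm) $ (j, snd r) $ (i, snd c)
      | (Inr j, Inr j') \<Rightarrow> 0))"

text \<open>The block row \<open>(H\<^sub>1 \<dots> H\<^sub>m G\<^sub>1 \<dots> G\<^sub>n)\<close>.\<close>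

definition HG_row ::
  "('m::finite \<Rightarrow> real^'p^'p) \<Rightarrow> ('n::finite \<Rightarrow> real^'p^'p)
    \<Rightarrow> real^(('m + 'n) \<times> 'p::finite)^'p" where
  "HG_row H G = (\<chi> a c. (case fst c of Inl i \<Rightarrow> H i | Inr j \<Rightarrow> G j) $ a $ snd c)"

definition bmi_plus ::
  "real^'p^'p \<Rightarrow> ('m::finite \<Rightarrow> real^'p^'p) \<Rightarrow> ('n::finite \<Rightarrow> real^'p^'p)
    \<Rightarrow> real^(('m + 'n) \<times> 'p::finite)^(('m + 'n) \<times> 'p) \<Rightarrow> real^('m + 'n) \<Rightarrow> real^'p^'p" where
  "bmi_plus F H G M\<^sub>1 z =
     transpose (z \<otimes>\<^sub>v mat 1) ** M\<^sub>1 ** (z \<otimes>\<^sub>v mat 1)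
       + HG_row H G ** (z \<otimes>\<^sub>v mat 1) + F"

definition bmi_minus ::
  "real^(('m::finite + 'n::finite) \<times> 'p::finite)^(('m + 'n) \<times> 'p)
    \<Rightarrow> real^('m + 'n) \<Rightarrow> real^'p^'p" where
  "bmi_minus M\<^sub>2 z = transpose (z \<otimes>\<^sub>v mat 1) ** M\<^sub>2 ** (z \<otimes>\<^sub>v mat 1)"

definition partial_deriv ::
  "(real^'k \<Rightarrow> 'b::real_normed_vector) \<Rightarrow> 'k::finite \<Rightarrow> real^'k \<Rightarrow> 'b" where
  "partial_deriv f i z = vector_derivative (\<lambda>t. f (z + t *\<^sub>R axis i 1)) (at 0)"

definition diff_map ::
  "(real^'k \<Rightarrow> 'b::real_normed_vector) \<Rightarrow> real^'k \<Rightarrow> real^'k::finite \<Rightarrow> 'b" where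
  "diff_map f z u = (\<Sum>i\<in>UNIV. (u $ i) *\<^sub>R partial_deriv f i z)"

end

theory Submission
  imports Defs
begin

text \<open>
  The map \<open>\<B>\<^sup>-\<close> is the quadratic form of a bilinear matrix-valued map, so the error of
  its linearisation at \<open>z\<close> is exactly \<open>\<B>\<^sup>-(w - z)\<close>, which is positive semidefinite because
  \<open>M\<^sub>2\<close> is. Hence the constraint of the convex subproblem majorises \<open>\<B>\<close>, and every feasible
  point of a subproblem is feasible for the bilinear matrix inequality.
\<close>

lemma sum_UNIV_Plus:
  "(\<Sum>r\<in>(UNIV::('m::finite + 'n::finite) set). f r)
    = (\<Sum>i\<in>UNIV. f (Inl i)) + (\<Sum>j\<in>UNIV. f (Inr j))"
  using sum.Plus[of "UNIV::'m set" "UNIV::'n set" f] by (simp add: UNIV_Plus_UNIV)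

lemma sum_UNIV_Times:
  "(\<Sum>r\<in>(UNIV::('a::finite \<times> 'b::finite) set). f r) = (\<Sum>i\<in>UNIV. \<Sum>a\<in>UNIV. f (i, a))"
  unfolding UNIV_Times_UNIV[symmetric] by (simp add: sum.cartesian_product)

text \<open>The identity factor in \<open>z \<otimes>\<^sub>v mat 1\<close> collapses the sum over
  the inner index, so only block indices remain. With the transposed version below, this lets the
  matrix identities be checked entrywise as scalar sums.\<close>

lemma matrix_mult_kron_vec_component:
  fixes A :: "real^('k::finite \<times> 'p::finite)^'q"
  shows "(A ** (z \<otimes>\<^sub>v mat 1)) $ a $ b = (\<Sum>s\<in>UNIV. A $ a $ (s, b) * z $ s)"
  by (simp add: matrix_matrix_mult_def kron_vec_def sum_UNIV_Times mat_def
      if_distrib cong: if_cong)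

lemma transpose_kron_vec_mult_component:
  fixes A :: "real^'q^('k::finite \<times> 'p::finite)"
  shows "(transpose (z \<otimes>\<^sub>v mat 1) ** A) $ a $ b = (\<Sum>r\<in>UNIV. z $ r * A $ (r, a) $ b)"
  by (simp add: matrix_matrix_mult_def kron_vec_def transpose_def sum_UNIV_Times mat_def
      if_distrib if_distribR cong: if_cong)

lemma transpose_kron_vec_mult_diff:
  fixes A B :: "real^('k::finite \<times> 'p::finite)^('k \<times> 'p)"
  shows "transpose (z \<otimes>\<^sub>v mat 1) ** (A - B) ** (z \<otimes>\<^sub>v mat 1)
    = transpose (z \<otimes>\<^sub>v mat 1) ** A ** (z \<otimes>\<^sub>v mat 1)
      - transpose (z \<otimes>\<^sub>v mat 1) ** B ** (z \<otimes>\<^sub>v mat 1)"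
  by (simp add: vec_eq_iff matrix_mult_kron_vec_component transpose_kron_vec_mult_component
      left_diff_distrib right_diff_distrib sum_subtractf)

text \<open>Each product \<open>x_i y_j\<close> is produced twice by \<open>M_mat Fm\<close>, once
  by \<open>Gamma_mat\<close> and once by its transpose, each time with weight 1/2. The splitting
  then distributes this quadratic part over the two convex maps.\<close>

lemma bmi_eq_plus_minus:
  fixes Fm :: "'m::finite \<Rightarrow> 'n::finite \<Rightarrow> real^'p^'p"
  assumes sym: "\<And>i j. sym_matrix (Fm i j)"
    and M: "M_mat Fm = M\<^sub>1 - M\<^sub>2"
  shows "bmi F H G Fm (x_part z) (y_part z) = bmi_plus F H G M\<^sub>1 z - bmi_minus M\<^sub>2 z"
proof -
  \<comment> \<open>The lower left block of \<open>M_mat\<close> carries the transpose of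
    \<open>Fm i j\<close>; symmetry turns its entries back into those of the upper right
    block.\<close>
  have F_sym: "Fm i j $ b $ a = Fm i j $ a $ b" for i j a b
    using arg_cong[OF sym[unfolded sym_matrix_def, of i j], of "\<lambda>A. A $ a $ b"]
    by (simp add: transpose_def)
  have quad: "transpose (z \<otimes>\<^sub>v mat 1) ** M_mat Fm ** (z \<otimes>\<^sub>v mat 1)
      = (\<Sum>i\<in>UNIV. \<Sum>j\<in>UNIV. (x_part z $ i * y_part z $ j) *\<^sub>R Fm i j)" (is "?L = ?R")
  proof -
    have "?L $ a $ b = ?R $ a $ b" for a b
    proof -
      have "?L $ a $ b
          = (\<Sum>i\<in>UNIV. \<Sum>j\<in>UNIV. z $ Inl i * z $ Inr j * Fm i j $ a $ b / 2)
          + (\<Sum>j\<in>UNIV. \<Sum>i\<in>UNIV. z $ Inl i * z $ Inr j * Fm i j $ a $ b / 2)"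
        unfolding matrix_mult_kron_vec_component transpose_kron_vec_mult_component
        by (simp add: sum_UNIV_Plus M_mat_def Gamma_mat_def transpose_def F_sym
            sum_distrib_left sum_distrib_right mult_ac)
      also have "\<dots> = (\<Sum>i\<in>UNIV. \<Sum>j\<in>UNIV. z $ Inl i * z $ Inr j * Fm i j $ a $ b)"
        \<comment> \<open>The second double sum comes from the lower left block; after the swap both
          halves have the same order of summation and add up.\<close>
        by (subst (2) sum.swap) (simp add: mult.assoc flip: sum.distrib)
      finally show ?thesis
        by (simp add: x_part_def y_part_def)
    qed
    then show ?thesis by (simp add: vec_eq_iff)
  qed
  have lin: "HG_row H G ** (z \<otimes>\<^sub>v mat 1)
      = (\<Sum>i\<in>UNIV. (x_part z $ i) *\<^sub>R H i) + (\<Sum>j\<in>UNIV. (y_part z $ j) *\<^sub>R G j)"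
    by (simp add: vec_eq_iff matrix_mult_kron_vec_component sum_UNIV_Plus HG_row_def
        x_part_def y_part_def mult.commute)
  show ?thesis
    unfolding bmi_def bmi_plus_def bmi_minus_def lin quad[symmetric] M
    by (simp add: transpose_kron_vec_mult_diff)
qed

text \<open>Product rule along each axis, then linearity in the direction. \<open>B\<close> may be
  asymmetric, so both cross terms are kept.\<close>

lemma diff_map_bilinear:
  fixes B :: "real^'k::finite \<Rightarrow> real^'k \<Rightarrow> 'b::real_normed_vector"
  assumes B: "bilinear B"
  shows "diff_map (\<lambda>z. B z z) z u = B u z + B z u"
proof -
  have pd: "partial_deriv (\<lambda>z. B z z) i z = B (axis i 1) z + B z (axis i 1)" for i
  proof -
    let ?e = "axis i 1 :: real^'k"
    \<comment> \<open>An exact quadratic polynomial in \<open>t\<close>: the derivative at 0 is the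
      coefficient of \<open>t\<close>.\<close>
    have "B (z + t *\<^sub>R ?e) (z + t *\<^sub>R ?e) = B z z + t *\<^sub>R (B ?e z + B z ?e) + t\<^sup>2 *\<^sub>R B ?e ?e" for t
      using B by (simp add: bilinear_ladd bilinear_radd bilinear_lmul bilinear_rmul
          scaleR_add_right power2_eq_square)
    moreover have "((\<lambda>t. B z z + t *\<^sub>R (B ?e z + B z ?e) + t\<^sup>2 *\<^sub>R B ?e ?e)
        has_vector_derivative B ?e z + B z ?e) (at 0)"
      by (auto intro!: derivative_eq_intros)
    ultimately show ?thesis
      unfolding partial_deriv_def by (simp only: vector_derivative_at)
  qed
  have u: "u = (\<Sum>i\<in>UNIV. u $ i *\<^sub>R axis i 1)"
    using basis_expansion[of u] by (simp add: scalar_mult_eq_scaleR)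
  have "linear (\<lambda>x. B x z)"
    using B by (simp add: bilinear_def)
  then have "B u z = (\<Sum>i\<in>UNIV. u $ i *\<^sub>R B (axis i 1) z)"
    by (subst u) (simp only: linear_sum[where f = "\<lambda>x. B x z"] linear_scale[where f = "\<lambda>x. B x z"])
  moreover have "B z u = (\<Sum>i\<in>UNIV. u $ i *\<^sub>R B z (axis i 1))"
    using B by (subst u) (simp add: bilinear_def linear_sum linear_scale)
  ultimately show ?thesis
    by (simp add: diff_map_def pd scaleR_add_right sum.distrib)
qed

lemma bilinear_kron_form:
  fixes M :: "real^('k::finite \<times> 'p::finite)^('k \<times> 'p)"
  shows "bilinear (\<lambda>u w. transpose (u \<otimes>\<^sub>v mat 1) ** M ** (w \<otimes>\<^sub>v mat 1))"
  unfolding bilinear_def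
  by (auto intro!: linearI simp: vec_eq_iff matrix_mult_kron_vec_component
      transpose_kron_vec_mult_component algebra_simps sum.distrib sum_distrib_left
      sum_distrib_right)

text \<open>With \<open>d = w - z\<close>, expanding \<open>?B (z + d) (z + d)\<close> leaves
  exactly \<open>?B d d\<close> beyond the value and the differential at \<open>z\<close>.\<close>

lemma bmi_minus_linearization_error:
  "bmi_minus M z + diff_map (bmi_minus M) z (w - z) = bmi_minus M w - bmi_minus M (w - z)"
proof -
  let ?B = "\<lambda>u w. transpose (u \<otimes>\<^sub>v mat 1) ** M ** (w \<otimes>\<^sub>v mat 1)"
  have B: "bilinear ?B" by (rule bilinear_kron_form)
  have Q: "bmi_minus M = (\<lambda>z. ?B z z)" by (simp add: fun_eq_iff bmi_minus_def)
  show ?thesis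
    unfolding Q diff_map_bilinear[OF B]
    by (simp add: bilinear_lsub[OF B] bilinear_rsub[OF B])
qed

text \<open>The form at \<open>v\<close> is the form of \<open>A\<close> at \<open>K *v v\<close>.
  It is used with \<open>K = z \<otimes>\<^sub>v mat 1\<close> to get semidefinite values of
  \<open>bmi_minus\<close>.\<close>

lemma psd_congruence:
  fixes A :: "real^'a::finite^'a" and K :: "real^'b::finite^'a"
  assumes "psd A"
  shows "psd (transpose K ** A ** K)"
proof -
  have "v \<bullet> ((transpose K ** A ** K) *v v) = (K *v v) \<bullet> (A *v (K *v v))" for v
    by (metis dot_lmul_matrix inner_commute matrix_vector_mul_assoc transpose_matrix_vector)
  with assms show ?thesis
    by (simp add: psd_def sym_matrix_def matrix_transpose_mul matrix_mul_assoc)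
qed

lemma psd_bmi_minus: "0 \<preceq> M \<Longrightarrow> psd (bmi_minus M z)"
  by (simp add: bmi_minus_def loewner_le_def psd_congruence)

lemma psd_add: "psd A \<Longrightarrow> psd B \<Longrightarrow> psd (A + B)"
  by (auto simp: psd_def sym_matrix_def transpose_def vec_eq_iff
      matrix_vector_mult_add_rdistrib inner_add_right)

lemma pos_def_imp_psd: "pos_def A \<Longrightarrow> psd A"
  unfolding pos_def_def psd_def by (metis inner_zero_left less_eq_real_def)

theorem theorem9:
  fixes F :: "real^'p^'p"
    and H :: "'m::finite \<Rightarrow> real^'p^'p"
    and G :: "'n::finite \<Rightarrow> real^'p^'p"
    and Fm :: "'m \<Rightarrow> 'n \<Rightarrow> real^'p^'p"
    and M\<^sub>1 M\<^sub>2 :: "real^(('m + 'n) \<times> 'p)^(('m + 'n) \<times> 'p)"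
    and g :: "real^('m + 'n) \<Rightarrow> real"
    and \<delta> :: real
    and z :: "nat \<Rightarrow> real^('m + 'n)"
    and k :: nat
  assumes "sym_matrix F" and "\<And>i. sym_matrix (H i)" and "\<And>j. sym_matrix (G j)"
    and "\<And>i j. sym_matrix (Fm i j)"
    and "M_mat Fm = M\<^sub>1 - M\<^sub>2" and "0 \<preceq> M\<^sub>1" and "0 \<preceq> M\<^sub>2"
    and "linear g"
    and "\<delta> < 0"
    and "bmi F H G Fm (x_part (z 0)) (y_part (z 0)) \<prec> 0"
    and "\<And>l. l < k \<Longrightarrow>
      is_arg_max (\<lambda>w. g w + 1/2 * \<delta> * (norm (w - z l))\<^sup>2)
        (\<lambda>w. bmi_plus F H G M\<^sub>1 w - bmi_minus M\<^sub>2 (z l)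
               - diff_map (bmi_minus M\<^sub>2) (z l) (w - z l) \<preceq> 0)
        (z (Suc l))"
  shows "\<forall>i\<le>k. bmi F H G Fm (x_part (z i)) (y_part (z i)) \<preceq> 0"
proof (intro allI impI)
  fix i assume "i \<le> k"
  show "bmi F H G Fm (x_part (z i)) (y_part (z i)) \<preceq> 0"
  proof (cases i)
    case 0
    with assms(10) show ?thesis
      by (simp add: loewner_less_def loewner_le_def pos_def_imp_psd)
  next
    case (Suc l)
    \<comment> \<open>An optimal solution is in particular feasible for its own subproblem, the one
      linearised at \<open>z l\<close>.\<close>
    have "psd (- (bmi_plus F H G M\<^sub>1 (z i) - bmi_minus M\<^sub>2 (z l)
        - diff_map (bmi_minus M\<^sub>2) (z l) (z i - z l)))"
      using assms(11)[of l] \<open>i \<le> k\<close> Suc by (simp add: is_arg_max_def loewner_le_def)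
    \<comment> \<open>Adding the linearisation error \<open>bmi_minus M\<^sub>2 (z i - z l)\<close>
      replaces the linearisation by the true value \<open>bmi_minus M\<^sub>2 (z i)\<close>.\<close>
    from psd_add[OF this psd_bmi_minus[OF assms(7), of "z i - z l"]]
    have "psd (- (bmi_plus F H G M\<^sub>1 (z i) - bmi_minus M\<^sub>2 (z i)))"
      using bmi_minus_linearization_error[of M\<^sub>2 "z l" "z i"] by (simp add: algebra_simps)
    then show ?thesis
      by (simp add: loewner_le_def bmi_eq_plus_minus[OF assms(4,5)])
  qed
qed

end
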